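(* Let $R$ be a polynomial ring over a field and let $I_1,\dots,I_d$ ($d\ge 1$) be non-zero ideals of $R$, each generated by linear forms. For a non-empty subset $A\subseteq\{1,\dots,d\}$ set $I_A=\sum_{j\in A}I_j$ and let $|A|$ be the cardinality of $A$. Then $$I_1\cdots I_d=\bigcap_{\emptyset\ne A\subseteq\{1,\dots,d\}} I_A^{|A|}$$ is a (possibly redundant) primary decomposition of $I_1\cdots I_d$; that is, the displayed equality holds and each ideal $I_A^{|A|}$ is primary.
   Context: $R=K[x_1,\dots,x_n]$ with $K$ a field and the standard grading; a linear form is a homogeneous element of degree $1$. *)

theory Defs
  imports "HOL-Library.Poly_Mapping" "HOL-Algebra.Ideal_Product"
begin

text \<open>A monomial is a finitely supported exponent vector \<open>nat \<Rightarrow>\<^sub>0 nat\<close>, with the index \<open>i\<close> standing for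
  the variable \<open>x\<^sub>i\<close>, and a polynomial is a finitely supported family of coefficients indexed by
  monomials.  The multiplication on \<open>'k mpoly\<close> is the convolution product of
  \<^theory>\<open>HOL-Library.Poly_Mapping\<close>.\<close>

type_synonym 'k mpoly = "(nat \<Rightarrow>\<^sub>0 nat) \<Rightarrow>\<^sub>0 'k"

text \<open>The polynomial ring \<open>K[x\<^sub>1, \<dots>, x\<^sub>n]\<close>: the polynomials in which only
  \<open>x\<^sub>1, \<dots>, x\<^sub>n\<close> occur.\<close>

definition poly_ring :: "nat \<Rightarrow> ('k::field) mpoly ring" where
  "poly_ring n =
    \<lparr>carrier = {p. \<forall>m\<in>Poly_Mapping.keys p. Poly_Mapping.keys m \<subseteq> {1..n}},
     monoid.mult = (\<lambda>p q. p * q),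
     one = 1,
     zero = 0,
     add = (\<lambda>p q. p + q)\<rparr>"

definition monom_deg :: "(nat \<Rightarrow>\<^sub>0 nat) \<Rightarrow> nat" where
  "monom_deg m = (\<Sum>i\<in>Poly_Mapping.keys m. Poly_Mapping.lookup m i)"

text \<open>As usual, the zero polynomial is homogeneous of every degree.\<close>

definition homogeneous :: "nat \<Rightarrow> ('k::field) mpoly \<Rightarrow> bool" where
  "homogeneous e p \<longleftrightarrow> (\<forall>m\<in>Poly_Mapping.keys p. monom_deg m = e)"

definition linear_forms :: "nat \<Rightarrow> ('k::field) mpoly set" where
  "linear_forms n = {p \<in> carrier (poly_ring n). homogeneous 1 p}"

definition generated_by_linear_forms :: "nat \<Rightarrow> ('k::field) mpoly set \<Rightarrow> bool" where
  "generated_by_linear_forms n I \<longleftrightarrow> (\<exists>S \<subseteq> linear_forms n. I = Idl\<^bsub>poly_ring n\<^esub> S)"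

locale primaryideal = ideal + cring +
  assumes I_notcarr: "carrier R \<noteq> I"
    and I_primary: "\<lbrakk>a \<in> carrier R; b \<in> carrier R; a \<otimes> b \<in> I\<rbrakk>
      \<Longrightarrow> a \<in> I \<or> (\<exists>k>0. b [^] (k::nat) \<in> I)"

lemma cring_poly_ring: "cring (poly_ring n :: ('k::field) mpoly ring)"
proof -
  let ?R = "poly_ring n :: 'k mpoly ring"
  have ops: "x \<oplus>\<^bsub>?R\<^esub> y = x + y" "x \<otimes>\<^bsub>?R\<^esub> y = x * y" "\<zero>\<^bsub>?R\<^esub> = 0" "\<one>\<^bsub>?R\<^esub> = 1" for x y
    by (simp_all add: poly_ring_def)
  have carr: "p \<in> carrier ?R \<longleftrightarrow>
      (\<forall>m\<in>Poly_Mapping.keys p. Poly_Mapping.keys m \<subseteq> {1..n})" for p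
    by (simp add: poly_ring_def)
  have add: "p + q \<in> carrier ?R" if "p \<in> carrier ?R" "q \<in> carrier ?R" for p q
    using that keys_add[of p q] unfolding carr by blast
  have mult: "p * q \<in> carrier ?R" if p: "p \<in> carrier ?R" and q: "q \<in> carrier ?R" for p q
    unfolding carr
  proof
    fix m assume "m \<in> Poly_Mapping.keys (p * q)"
    then obtain a b where "a \<in> Poly_Mapping.keys p" "b \<in> Poly_Mapping.keys q" "m = a + b"
      using keys_mult[of p q] by blast
    then show "Poly_Mapping.keys m \<subseteq> {1..n}"
      using p q keys_add[of a b] unfolding carr by blast
  qed
  have neg: "- p \<in> carrier ?R" if "p \<in> carrier ?R" for p
    using that by (simp add: carr)
  have zero: "0 \<in> carrier ?R" and one: "1 \<in> carrier ?R"
    by (simp_all add: carr)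
  show ?thesis
  proof (rule cringI)
    show "abelian_group ?R"
    proof (rule abelian_groupI)
      show "\<exists>q\<in>carrier ?R. q \<oplus>\<^bsub>?R\<^esub> p = \<zero>\<^bsub>?R\<^esub>" if "p \<in> carrier ?R" for p
        using neg[OF that] by (intro bexI[of _ "- p"]) (simp_all add: ops)
    qed (simp_all add: ops add zero algebra_simps)
    show "Group.comm_monoid ?R"
      by (rule comm_monoidI) (simp_all add: ops mult one algebra_simps)
  qed (simp_all add: ops algebra_simps)
qed

end

theory Submission
  imports Defs "HOL-Computational_Algebra.Formal_Laurent_Series"
begin

text \<open>
  Only the inclusion of the intersection in the product has content: if \<open>A\<close> is a set of indices,
  then a product of one element of each \<open>I\<^sub>j\<close> contains \<open>|A|\<close> factors from \<open>I\<^sub>A\<close>.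

  Everything rests on one valuation.  Let \<open>W \<subseteq> U\<close> be spaces of linear forms.  Splitting every
  linear form into a part outside \<open>U\<close>, a part in \<open>U\<close> and a part in \<open>W\<close>, multiplying the second
  by a new variable \<open>t\<close> and discarding the third defines a ring homomorphism \<open>\<Phi>\<close> into the
  polynomials in \<open>t\<close>, and \<open>f\<close> lies in \<open>(U)\<^sup>k + (W)\<close> if and only if \<open>t\<^sup>k\<close> divides
  \<open>\<Phi> f\<close> (\<open>mem_product_ideal_iff\<close>).  Since orders in \<open>t\<close> add up, powers of \<open>(U)\<close> are
  primary, multiplication by a linear form \<open>x\<close> outside \<open>U\<close> is injective modulo
  \<open>(U)\<^sup>k + (W)\<close> (\<open>cancel_outside\<close>), and multiplication by a linear form \<open>x\<close> in \<open>U\<close> but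
  not in \<open>W\<close> raises the order by exactly one (\<open>cancel_inside\<close>).

  The inclusion is proved modulo an arbitrary space \<open>W\<close> of linear forms
  (\<open>Inter_powers_subset_product\<close>): writing \<open>S\<^sub>j\<close> for linear forms generating \<open>I\<^sub>j\<close> and
  \<open>U\<^sub>A\<close> for the span of \<open>W\<close> and all \<open>S\<^sub>j\<close> with \<open>j \<in> A\<close>, an element \<open>f\<close> of every
  \<open>(U\<^sub>A)\<^sup>|\<^sup>A\<^sup>| + (W)\<close> lies in \<open>\<Prod>\<^sub>j I\<^sub>j + (W)\<close>.  The induction is on the number of
  ideals and then on the codimension of \<open>W\<close> in the span \<open>U\<^sub>D\<close> for the full index set \<open>D\<close>.
  If \<open>U\<^sub>D = W\<close>, all the ideals involved are \<open>(W)\<close>.  Otherwise take \<open>x\<close> in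
  \<open>U\<^sub>D\<close> outside every \<open>U\<^sub>A\<close> that is smaller than \<open>U\<^sub>D\<close>.  Enlarging \<open>W\<close> by \<open>x\<close> gives
  \<open>f = g + x h\<close> with \<open>g \<in> \<Prod>\<^sub>j I\<^sub>j + (W)\<close>.  Then \<open>x h\<close> lies in every
  \<open>(U\<^sub>A)\<^sup>|\<^sup>A\<^sup>| + (W)\<close>, and cancelling \<open>x\<close> puts \<open>h\<close> into these ideals for all
  non-empty \<open>A \<subset> D\<close>: if \<open>U\<^sub>A \<noteq> U\<^sub>D\<close> because \<open>x \<notin> U\<^sub>A\<close>; if \<open>U\<^sub>A = U\<^sub>D\<close> because the
  condition for \<open>D\<close> has an exponent larger than \<open>|A|\<close>, which pays for the order of \<open>x\<close>.
  By induction \<open>h\<close> lies in the product of any \<open>|D| - 1\<close> of the ideals, modulo \<open>W\<close>.  Hence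
  \<open>s h\<close> lies in \<open>\<Prod>\<^sub>j I\<^sub>j + (W)\<close> for every generator \<open>s\<close> of every \<open>I\<^sub>j\<close>, thus so does
  \<open>x h\<close>, because \<open>x\<close> is a combination of such generators and of elements of \<open>W\<close>.

  A vector space is not a finite union of proper subspaces when the field is infinite, and this
  is where \<open>x\<close> comes from.  The ground field \<open>K\<close> is therefore first replaced by its field of
  Laurent series: \<open>embed\<close> includes the polynomials over \<open>K\<close> in those over the series field, and
  taking constant coefficients and dropping foreign variables gives an additive left inverse
  \<open>retract\<close> that is linear over the original ring.  So an ideal of the original ring is recovered
  from its extension, and membership in products, powers and sums can be tested there.
\<close>

section \<open>Polynomials as a free algebra\<close>

lemma poly_mapping_sum_single:
  "p = (\<Sum>k\<in>Poly_Mapping.keys p. Poly_Mapping.single k (Poly_Mapping.lookup p k))"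
  by (rule poly_mapping_eqI)
    (simp add: lookup_sum lookup_single when_def in_keys_iff sum.delta')

lemma poly_mapping_single_induct [case_names zero single add]:
  fixes p :: "'a \<Rightarrow>\<^sub>0 'b::comm_monoid_add"
  assumes "P 0" "\<And>k c. P (Poly_Mapping.single k c)" "\<And>p q. P p \<Longrightarrow> P q \<Longrightarrow> P (p + q)"
  shows "P p"
proof -
  have "P (\<Sum>k\<in>A. Poly_Mapping.single k (Poly_Mapping.lookup p k))" if "finite A" for A
    using that by induction (use assms in auto)
  from this[of "Poly_Mapping.keys p", OF finite_keys] show ?thesis
    by (simp flip: poly_mapping_sum_single)
qed

abbreviation const :: "'k::zero \<Rightarrow> 'k mpoly" where
  "const c \<equiv> Poly_Mapping.single 0 c"

definition var :: "nat \<Rightarrow> 'k::zero_neq_one mpoly" where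
  "var i = Poly_Mapping.single (Poly_Mapping.single i 1) 1"

lemma var_power: "var i ^ e = Poly_Mapping.single (Poly_Mapping.single i e) (1::'k::comm_ring_1)"
proof (induction e)
  case (Suc e)
  then show ?case
    by (simp add: var_def mult_single flip: single_add)
qed simp

lemma mpoly_induct [case_names const var add mult]:
  fixes p :: "'k::comm_ring_1 mpoly"
  assumes const: "\<And>c. P (const c)" and var: "\<And>i. P (var i)"
    and add: "\<And>p q. P p \<Longrightarrow> P q \<Longrightarrow> P (p + q)" and mult: "\<And>p q. P p \<Longrightarrow> P q \<Longrightarrow> P (p * q)"
  shows "P p"
proof (induction p rule: poly_mapping_single_induct)
  case zero
  show ?case using const[of 0] by simp
next
  case (single m c)
  have "P (var i ^ e)" for i e
    by (induction e) (use const[of 1] var mult in auto)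
  then have pow: "P (Poly_Mapping.single (Poly_Mapping.single i e) 1)" for i e
    by (simp add: var_power)
  have "P (Poly_Mapping.single m 1)"
  proof (induction m rule: poly_mapping_single_induct)
    case zero
    show ?case using const[of 1] by simp
  next
    case (single i e)
    show ?case by (rule pow)
  next
    case (add m m')
    then show ?case
      using mult[OF add] by (simp add: mult_single)
  qed
  from mult[OF const[of c] this] show ?case
    by (simp add: mult_single)
qed (rule add)

text \<open>All ring homomorphisms below are substitutions \<open>\<theta>\<close> for the variables, with \<open>\<phi>\<close> acting on
  the coefficients.\<close>

definition evaluate_monom :: "(nat \<Rightarrow> 'b::comm_ring_1) \<Rightarrow> (nat \<Rightarrow>\<^sub>0 nat) \<Rightarrow> 'b" where
  "evaluate_monom \<theta> m = (\<Prod>i\<in>Poly_Mapping.keys m. \<theta> i ^ Poly_Mapping.lookup m i)"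

definition evaluate :: "('k \<Rightarrow> 'b) \<Rightarrow> (nat \<Rightarrow> 'b) \<Rightarrow> 'k::comm_ring_1 mpoly \<Rightarrow> 'b::comm_ring_1" where
  "evaluate \<phi> \<theta> p = (\<Sum>m\<in>Poly_Mapping.keys p. \<phi> (Poly_Mapping.lookup p m) * evaluate_monom \<theta> m)"

lemma evaluate_monom_superset:
  assumes "finite A" "Poly_Mapping.keys m \<subseteq> A"
  shows "evaluate_monom \<theta> m = (\<Prod>i\<in>A. \<theta> i ^ Poly_Mapping.lookup m i)"
  unfolding evaluate_monom_def using assms
  by (intro prod.mono_neutral_left) (auto simp: in_keys_iff)

lemma evaluate_monom_add: "evaluate_monom \<theta> (m + m') = evaluate_monom \<theta> m * evaluate_monom \<theta> m'"
proof -
  let ?A = "Poly_Mapping.keys m \<union> Poly_Mapping.keys m'"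
  have "evaluate_monom \<theta> n = (\<Prod>i\<in>?A. \<theta> i ^ Poly_Mapping.lookup n i)"
    if "n \<in> {m, m', m + m'}" for n
    using that keys_add[of m m'] by (intro evaluate_monom_superset) auto
  then show ?thesis
    by (simp add: lookup_add power_add prod.distrib)
qed

lemma evaluate_monom_0 [simp]: "evaluate_monom \<theta> 0 = 1"
  by (simp add: evaluate_monom_def)

lemma evaluate_monom_single [simp]: "evaluate_monom \<theta> (Poly_Mapping.single i e) = \<theta> i ^ e"
  by (cases "e = 0") (simp_all add: evaluate_monom_def)

locale coefficient_hom =
  fixes \<phi> :: "'k::comm_ring_1 \<Rightarrow> 'b::comm_ring_1"
  assumes hom_add: "\<phi> (a + b) = \<phi> a + \<phi> b"
    and hom_mult: "\<phi> (a * b) = \<phi> a * \<phi> b"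
    and hom_1: "\<phi> 1 = 1"
begin

lemma hom_0: "\<phi> 0 = 0"
  using hom_add[of 0 0] by simp

lemma evaluate_add: "evaluate \<phi> \<theta> (p + q) = evaluate \<phi> \<theta> p + evaluate \<phi> \<theta> q"
  unfolding evaluate_def by (rule setsum_keys_plus_distrib) (simp_all add: hom_0 hom_add distrib_right)

lemma evaluate_0 [simp]: "evaluate \<phi> \<theta> 0 = 0"
  by (simp add: evaluate_def)

lemma evaluate_single [simp]: "evaluate \<phi> \<theta> (Poly_Mapping.single m c) = \<phi> c * evaluate_monom \<theta> m"
  by (cases "c = 0") (simp_all add: evaluate_def hom_0)

lemma evaluate_1 [simp]: "evaluate \<phi> \<theta> 1 = 1"
  using evaluate_single[of \<theta> 0 1] by (simp add: hom_1)

lemma evaluate_var [simp]: "evaluate \<phi> \<theta> (var i) = \<theta> i"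
  by (simp add: var_def hom_1)

lemma evaluate_mult: "evaluate \<phi> \<theta> (p * q) = evaluate \<phi> \<theta> p * evaluate \<phi> \<theta> q"
proof (induction p rule: poly_mapping_single_induct)
  case (single m c)
  show ?case
    by (induction q rule: poly_mapping_single_induct)
      (simp_all add: mult_single evaluate_monom_add hom_mult evaluate_add distrib_left)
qed (simp_all add: evaluate_add distrib_right)

lemma evaluate_prod: "evaluate \<phi> \<theta> (\<Prod>j\<in>A. v j) = (\<Prod>j\<in>A. evaluate \<phi> \<theta> (v j))"
  by (induction A rule: infinite_finite_induct) (simp_all add: evaluate_mult)

end

section \<open>Linear spans and ideals\<close>

interpretation lin: vector_space "\<lambda>c p. const c * p :: 'l::field mpoly"
  by unfold_locales (simp_all add: single_add mult_single distrib_left distrib_right flip: mult.assoc)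

text \<open>A commutative ring as a module over itself: subspaces are ideals, and the span of a set is
  the ideal that it generates.\<close>

interpretation ringmod: module "(*) :: 'a \<Rightarrow> 'a \<Rightarrow> 'a::comm_ring_1"
  by unfold_locales (simp_all add: algebra_simps)

text \<open>As scalars act by multiplication, \<open>scale_scale\<close> is associativity from right to left, which
  loops against the usual normal form of products.\<close>

declare lin.scale_scale [simp del] ringmod.scale_scale [simp del]

text \<open>The ideal \<open>\<Prod>\<^sub>j (V\<^sub>j) + (W)\<close>, the product running over \<open>j \<in> A\<close>.  A constant family
  gives the power \<open>(U)\<^sup>|\<^sup>A\<^sup>| + (W)\<close>; indexing powers by sets makes them comparable with products
  over subsets of the same index set.\<close>

definition product_ideal :: "('i \<Rightarrow> 'a set) \<Rightarrow> 'i set \<Rightarrow> 'a set \<Rightarrow> 'a::comm_ring_1 set" where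
  "product_ideal V A W = ringmod.span ({\<Prod>j\<in>A. v j |v. \<forall>j\<in>A. v j \<in> V j} \<union> W)"

lemma product_ideal_mono:
  assumes "\<And>j. j \<in> A \<Longrightarrow> V j \<subseteq> V' j" "W \<subseteq> W'"
  shows "product_ideal V A W \<subseteq> product_ideal V' A W'"
  unfolding product_ideal_def using assms by (intro ringmod.span_mono Un_mono) blast+

lemma product_ideal_empty [simp]: "product_ideal V {} W = UNIV"
proof -
  have "1 \<in> product_ideal V {} W"
    unfolding product_ideal_def by (intro ringmod.span_base) auto
  then have "a * 1 \<in> product_ideal V {} W" for a
    unfolding product_ideal_def by (rule ringmod.span_scale)
  then show ?thesis by auto
qed

lemma product_ideal_add: "f \<in> product_ideal V A W \<Longrightarrow> g \<in> product_ideal V A W \<Longrightarrow> f + g \<in> product_ideal V A W"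
  and product_ideal_diff: "f \<in> product_ideal V A W \<Longrightarrow> g \<in> product_ideal V A W \<Longrightarrow> f - g \<in> product_ideal V A W"
  and product_ideal_scale: "f \<in> product_ideal V A W \<Longrightarrow> a * f \<in> product_ideal V A W"
  and product_ideal_zero: "0 \<in> product_ideal V A W"
  and product_ideal_base: "w \<in> W \<Longrightarrow> w \<in> product_ideal V A W"
  unfolding product_ideal_def
  by (auto intro: ringmod.span_add ringmod.span_diff ringmod.span_scale ringmod.span_zero ringmod.span_base)

lemma product_ideal_prod:
  assumes "\<And>j. j \<in> A \<Longrightarrow> v j \<in> V j"
  shows "(\<Prod>j\<in>A. v j) \<in> product_ideal V A W"
  unfolding product_ideal_def using assms by (intro ringmod.span_base) blast

lemma product_ideal_insert:
  assumes j: "finite A" "j \<notin> A" and a: "a \<in> ringmod.span (V j)" and f: "f \<in> product_ideal V A W"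
  shows "a * f \<in> product_ideal V (insert j A) W"
proof -
  have vf: "v * f \<in> product_ideal V (insert j A) W" if v: "v \<in> V j" for v
    using f unfolding product_ideal_def[of V A W]
  proof (induction rule: ringmod.span_induct_alt)
    case base
    show ?case by (simp add: product_ideal_zero)
  next
    case (step c x y)
    have "v * x \<in> product_ideal V (insert j A) W"
    proof (cases "x \<in> W")
      case True
      then show ?thesis by (intro product_ideal_scale product_ideal_base)
    next
      case False
      with step obtain u where u: "x = (\<Prod>i\<in>A. u i)" "\<forall>i\<in>A. u i \<in> V i"
        by auto
      have "(\<Prod>i\<in>A. (u(j := v)) i) = x"
        unfolding u(1) using j(2) by (intro prod.cong) auto
      then have "v * x = (\<Prod>i\<in>insert j A. (u(j := v)) i)"
        using j by simp
      also have "\<dots> \<in> product_ideal V (insert j A) W"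
        by (rule product_ideal_prod) (use u v in auto)
      finally show ?thesis .
    qed
    then have "c * (v * x) + v * y \<in> product_ideal V (insert j A) W"
      using step by (intro product_ideal_add product_ideal_scale[of "v * x"])
    then show ?case by (simp add: algebra_simps)
  qed
  show ?thesis
    using a
  proof (induction rule: ringmod.span_induct_alt)
    case (step c x y)
    have "c * (x * f) + y * f \<in> product_ideal V (insert j A) W"
      using step vf by (intro product_ideal_add product_ideal_scale[of "x * f"])
    then show ?case by (simp add: algebra_simps)
  qed (simp add: product_ideal_zero)
qed

lemma product_ideal_least:
  assumes J: "ringmod.subspace J" and W: "W \<subseteq> J"
    and "\<And>v. (\<And>j. j \<in> A \<Longrightarrow> v j \<in> V j) \<Longrightarrow> (\<Prod>j\<in>A. v j) \<in> J"
  shows "product_ideal V A W \<subseteq> J"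
  unfolding product_ideal_def using assms by (intro ringmod.span_minimal) auto

lemma subspace_product_ideal: "ringmod.subspace (product_ideal V A W)"
  by (simp add: product_ideal_def)

text \<open>Multilinearity: the factors may be enlarged to the ideals that they generate.\<close>

lemma product_ideal_span:
  assumes "finite A" "\<And>j. j \<in> A \<Longrightarrow> V' j \<subseteq> ringmod.span (V j)"
  shows "product_ideal V' A W \<subseteq> product_ideal V A W"
proof (rule product_ideal_least)
  fix v assume "\<And>j. j \<in> A \<Longrightarrow> v j \<in> V' j"
  with assms show "(\<Prod>j\<in>A. v j) \<in> product_ideal V A W"
    by (induction A) (auto intro!: product_ideal_insert)
qed (auto simp: subspace_product_ideal intro: product_ideal_base)

lemma product_ideal_antimono:
  assumes "finite A" "B \<subseteq> A"
  shows "product_ideal V A W \<subseteq> product_ideal V B W"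
proof (rule product_ideal_least)
  fix v assume v: "\<And>j. j \<in> A \<Longrightarrow> v j \<in> V j"
  have "(\<Prod>j\<in>A - B. v j) * (\<Prod>j\<in>B. v j) \<in> product_ideal V B W"
    using v assms by (intro product_ideal_scale product_ideal_prod) auto
  then show "(\<Prod>j\<in>A. v j) \<in> product_ideal V B W"
    using assms by (metis prod.subset_diff)
qed (auto simp: subspace_product_ideal intro: product_ideal_base)

lemma lin_span_subset_ideal: "lin.span S \<subseteq> ringmod.span S"
proof
  fix x assume "x \<in> lin.span S"
  then show "x \<in> ringmod.span S"
    by (induction rule: lin.span_induct_alt) (auto intro: ringmod.span_zero ringmod.span_add ringmod.span_scale ringmod.span_base)
qed

lemma product_ideal_mult:
  assumes "finite A" "finite B" "A \<inter> B = {}"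
    and f: "f \<in> product_ideal V A W" and g: "g \<in> product_ideal V B W"
  shows "f * g \<in> product_ideal V (A \<union> B) W"
proof -
  have "product_ideal V B W \<subseteq> {g. f * g \<in> product_ideal V (A \<union> B) W}"
  proof (rule product_ideal_least)
    show "ringmod.subspace {g. f * g \<in> product_ideal V (A \<union> B) W}"
      by (auto simp: ringmod.subspace_def product_ideal_zero distrib_left mult.left_commute[of f]
          intro: product_ideal_add product_ideal_scale)
    show "W \<subseteq> {g. f * g \<in> product_ideal V (A \<union> B) W}"
      by (auto intro: product_ideal_scale product_ideal_base)
    fix v assume v: "\<And>j. j \<in> B \<Longrightarrow> v j \<in> V j"
    have "f * (\<Prod>j\<in>B. v j) \<in> product_ideal V (A \<union> B) W"
      using assms(2,3) v
    proof (induction B)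
      case (insert b B)
      then have "v b * (f * (\<Prod>j\<in>B. v j)) \<in> product_ideal V (insert b (A \<union> B)) W"
        using assms(1) by (intro product_ideal_insert) (auto intro: ringmod.span_base)
      with insert show ?case by (simp add: mult.left_commute)
    qed (use f in simp)
    then show "(\<Prod>j\<in>B. v j) \<in> {g. f * g \<in> product_ideal V (A \<union> B) W}" by simp
  qed
  with g show ?thesis by blast
qed

text \<open>A power depends only on the number of factors, and higher powers are smaller.\<close>

lemma product_ideal_const_card:
  assumes "finite A" "finite B" "card B \<le> card A"
  shows "product_ideal (\<lambda>_. U) A W \<subseteq> product_ideal (\<lambda>_. U) B W"
proof -
  obtain A' where A': "A' \<subseteq> A" "card A' = card B"
    using assms(3) by (metis obtain_subset_with_card_n)
  with assms obtain h where h: "bij_betw h B A'"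
    by (metis finite_same_card_bij finite_subset)
  have "product_ideal (\<lambda>_. U) A' W \<subseteq> product_ideal (\<lambda>_. U) B W"
  proof (rule product_ideal_least)
    fix v assume "\<And>j. j \<in> A' \<Longrightarrow> v j \<in> U"
    then have "(\<Prod>j\<in>B. v (h j)) \<in> product_ideal (\<lambda>_. U) B W"
      using h by (intro product_ideal_prod) (auto dest: bij_betwE)
    then show "(\<Prod>j\<in>A'. v j) \<in> product_ideal (\<lambda>_. U) B W"
      by (simp add: prod.reindex_bij_betw[OF h])
  qed (auto simp: subspace_product_ideal intro: product_ideal_base)
  with product_ideal_antimono[OF assms(1) A'(1)] show ?thesis by blast
qed

section \<open>The order of vanishing along a flag of linear spaces\<close>

text \<open>Orders of vanishing at \<open>0\<close> add up, and that of \<open>F\<close> is at most \<open>e\<close>.\<close>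

lemma monom_dvd_cancel:
  fixes F G :: "'a::idom poly"
  assumes "coeff F e \<noteq> 0" "Polynomial.monom 1 (k + e) dvd F * G"
  shows "Polynomial.monom 1 k dvd G"
proof (cases "G = 0")
  case False
  have F: "F \<noteq> 0" "\<not> Polynomial.monom 1 (Suc e) dvd F"
    using assms(1) by (auto simp: monom_1_dvd_iff')
  then have "Polynomial.order 0 F \<le> e"
    by (simp add: monom_1_dvd_iff not_less_eq_eq)
  moreover have "k + e \<le> Polynomial.order 0 F + Polynomial.order 0 G"
    using assms(2) F(1) False by (simp add: monom_1_dvd_iff order_mult)
  ultimately show ?thesis
    using False by (simp add: monom_1_dvd_iff)
qed simp

text \<open>Arbitrary linear projections \<open>p\<close> onto \<open>U\<close> and \<open>q\<close> onto \<open>W\<close> split a linear form \<open>x\<close> into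
  \<open>x - p x\<close> outside \<open>U\<close>, \<open>p x - q x\<close> in \<open>U\<close> and \<open>q x\<close> in \<open>W\<close>.\<close>

locale linear_flag =
  fixes W U :: "'l::field mpoly set" and p q :: "'l mpoly \<Rightarrow> 'l mpoly"
  assumes W_subset: "W \<subseteq> U" and U_linear: "U \<subseteq> lin.span (range var)"
    and lin_p: "Vector_Spaces.linear (\<lambda>c p. const c * p) (\<lambda>c p. const c * p) p"
    and lin_q: "Vector_Spaces.linear (\<lambda>c p. const c * p) (\<lambda>c p. const c * p) q"
    and p_in: "p x \<in> U" and p_id: "u \<in> U \<Longrightarrow> p u = u"
    and q_in: "q x \<in> W" and q_id: "w \<in> W \<Longrightarrow> q w = w"
    and subspace_U: "lin.subspace U"
begin

sublocale p: Vector_Spaces.linear "\<lambda>c p. const c * p" "\<lambda>c p. const c * p" p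
  by (rule lin_p)

sublocale q: Vector_Spaces.linear "\<lambda>c p. const c * p" "\<lambda>c p. const c * p" q
  by (rule lin_q)

sublocale hom: coefficient_hom "\<lambda>c::'l. [:const c:]"
  by unfold_locales (simp_all add: single_add mult_single one_pCons mult.commute)

text \<open>The parameter \<open>t\<close> is the variable of the outer polynomial ring.  A linear form \<open>x\<close> goes to
  \<open>(x - p x) + t (p x - q x)\<close>: \<open>W\<close> is killed, \<open>U\<close> becomes divisible by \<open>t\<close>, and the value
  at \<open>t = 1\<close> differs from \<open>x\<close> by an element of \<open>W\<close>.\<close>

definition \<Phi> :: "'l mpoly \<Rightarrow> 'l mpoly poly" where
  "\<Phi> = evaluate (\<lambda>c. [:const c:]) (\<lambda>i. [:var i - p (var i), p (var i) - q (var i):])"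

lemmas \<Phi>_add = hom.evaluate_add[of "\<lambda>i. [:var i - p (var i), p (var i) - q (var i):]", folded \<Phi>_def]
lemmas \<Phi>_mult = hom.evaluate_mult[of "\<lambda>i. [:var i - p (var i), p (var i) - q (var i):]", folded \<Phi>_def]
lemmas \<Phi>_prod = hom.evaluate_prod[of "\<lambda>i. [:var i - p (var i), p (var i) - q (var i):]", folded \<Phi>_def]
lemmas \<Phi>_var = hom.evaluate_var[of "\<lambda>i. [:var i - p (var i), p (var i) - q (var i):]", folded \<Phi>_def]

lemma \<Phi>_const [simp]: "\<Phi> (const c) = [:const c:]"
  by (simp add: \<Phi>_def)

lemma \<Phi>_linear: "x \<in> lin.span (range var) \<Longrightarrow> \<Phi> x = [:x - p x, p x - q x:]"
proof (induction rule: lin.span_induct_alt)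
  case base
  show ?case using \<Phi>_const[of 0] by (simp)
next
  case (step c x y)
  then obtain i where i: "x = var i" by auto
  have "\<Phi> (const c * x + y) = [:const c * x - const c * p x, const c * p x - const c * q x:]
      + [:y - p y, p y - q y:]"
    using step.IH by (simp add: \<Phi>_add \<Phi>_mult i \<Phi>_var right_diff_distrib' mult.commute[of _ "const c"])
  then show ?case by (simp add: p.add q.add p.scale q.scale)
qed

text \<open>The coefficient of \<open>t\<^sup>i\<close> is an element of \<open>(U)\<^sup>i\<close>: each factor \<open>t\<close> comes with a factor in
  \<open>U\<close>.\<close>

lemma coeff_\<Phi>: "coeff (\<Phi> f) i \<in> product_ideal (\<lambda>_. U) {..<i} {}"
proof (induction f arbitrary: i rule: mpoly_induct)
  case (const c)
  then show ?case by (cases i) (auto simp: product_ideal_zero)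
next
  case (var j)
  have "p (var j) - q (var j) \<in> U"
    using p_in q_in W_subset subspace_U by (blast intro: lin.subspace_diff)
  then have "p (var j) - q (var j) \<in> product_ideal (\<lambda>_. U) {..<Suc 0} {}"
    using product_ideal_prod[of "{..<Suc 0}" "\<lambda>_. p (var j) - q (var j)" "\<lambda>_. U" "{}"] by simp
  then show ?case
    by (auto simp: \<Phi>_var coeff_pCons product_ideal_zero split: nat.splits)
next
  case (add f g)
  then show ?case by (simp add: \<Phi>_add product_ideal_add)
next
  case (mult f g)
  have "coeff (\<Phi> f) j * coeff (\<Phi> g) (i - j) \<in> product_ideal (\<lambda>_. U) {..<i} {}" if "j \<le> i" for j
  proof -
    have "coeff (\<Phi> g) (i - j) \<in> product_ideal (\<lambda>_. U) {j..<i} {}"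
      using mult.IH(2) product_ideal_const_card[of "{..<i - j}" "{j..<i}" U "{}"] by auto
    with mult.IH(1)[of j] have "coeff (\<Phi> f) j * coeff (\<Phi> g) (i - j) \<in> product_ideal (\<lambda>_. U) ({..<j} \<union> {j..<i}) {}"
      by (intro product_ideal_mult) auto
    with that show ?thesis by (simp add: ivl_disj_un)
  qed
  then show ?case
    unfolding \<Phi>_mult coeff_mult product_ideal_def by (intro ringmod.span_sum) simp
qed

lemma \<Phi>_specialize: "f - poly (\<Phi> f) 1 \<in> ringmod.span W"
proof (induction f rule: mpoly_induct)
  case (const c)
  show ?case by (simp add: ringmod.span_zero)
next
  case (var i)
  show ?case using q_in by (simp add: \<Phi>_var ringmod.span_base)
next
  case (add f g)
  then have "(f - poly (\<Phi> f) 1) + (g - poly (\<Phi> g) 1) \<in> ringmod.span W"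
    by (rule ringmod.span_add)
  then show ?case by (simp add: \<Phi>_add algebra_simps)
next
  case (mult f g)
  have "f * g - poly (\<Phi> (f * g)) 1
      = g * (f - poly (\<Phi> f) 1) + poly (\<Phi> f) 1 * (g - poly (\<Phi> g) 1)"
    by (simp add: \<Phi>_mult algebra_simps)
  with mult show ?case by (simp add: ringmod.span_add ringmod.span_scale)
qed

text \<open>If \<open>t\<^sup>k\<close> divides \<open>\<Phi> f\<close>, all nonzero coefficients of \<open>\<Phi> f\<close> lie in \<open>(U)\<^sup>k\<close>, hence so
  does their sum, which is the value at \<open>t = 1\<close> and agrees with \<open>f\<close> modulo \<open>W\<close>.\<close>

lemma mem_product_ideal_iff:
  assumes A: "finite A"
  shows "f \<in> product_ideal (\<lambda>_. U) A W \<longleftrightarrow> Polynomial.monom 1 (card A) dvd \<Phi> f"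
proof
  let ?J = "{f. Polynomial.monom 1 (card A) dvd \<Phi> f}"
  have "product_ideal (\<lambda>_. U) A W \<subseteq> ?J"
  proof (rule product_ideal_least)
    show "ringmod.subspace ?J"
      using \<Phi>_const[of 0] by (auto simp: ringmod.subspace_def \<Phi>_add \<Phi>_mult)
    show "W \<subseteq> ?J"
      using W_subset U_linear p_id q_id by (auto simp: \<Phi>_linear subset_iff)
    fix v assume v: "\<And>j. j \<in> A \<Longrightarrow> v j \<in> U"
    have "Polynomial.monom 1 1 dvd \<Phi> (v j)" if "j \<in> A" for j
      using v[OF that] U_linear p_id by (auto simp: \<Phi>_linear subset_iff monom_1_dvd_iff')
    with A have "Polynomial.monom 1 (card A) dvd (\<Prod>j\<in>A. \<Phi> (v j))"
    proof (induction A)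
      case (insert j A)
      then have "Polynomial.monom 1 1 * Polynomial.monom 1 (card A) dvd \<Phi> (v j) * (\<Prod>j\<in>A. \<Phi> (v j))"
        by (intro mult_dvd_mono) auto
      with insert.hyps show ?case by (simp add: mult_monom)
    qed simp
    then show "(\<Prod>j\<in>A. v j) \<in> ?J" by (simp add: \<Phi>_prod)
  qed
  then show "f \<in> product_ideal (\<lambda>_. U) A W \<Longrightarrow> Polynomial.monom 1 (card A) dvd \<Phi> f"
    by blast
next
  assume *: "Polynomial.monom 1 (card A) dvd \<Phi> f"
  have "coeff (\<Phi> f) i \<in> product_ideal (\<lambda>_. U) A W" for i
  proof (cases "i < card A")
    case True
    with * show ?thesis by (simp add: monom_1_dvd_iff' product_ideal_zero)
  next
    case False
    with A coeff_\<Phi>[of f i] show ?thesis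
      using product_ideal_const_card[of "{..<i}" A U "{}"] product_ideal_mono[of A "\<lambda>_. U" "\<lambda>_. U" "{}" W]
      by auto
  qed
  then have "poly (\<Phi> f) 1 \<in> product_ideal (\<lambda>_. U) A W"
    unfolding poly_altdef product_ideal_def by (intro ringmod.span_sum) simp
  moreover have "f - poly (\<Phi> f) 1 \<in> product_ideal (\<lambda>_. U) A W"
    using \<Phi>_specialize ringmod.span_mono[of W] unfolding product_ideal_def by blast
  ultimately show "f \<in> product_ideal (\<lambda>_. U) A W"
    using product_ideal_add by fastforce
qed

text \<open>The homomorphism \<open>\<Phi>\<close> gives \<open>x\<close> the order \<open>0\<close>.\<close>

lemma cancel_outside:
  assumes "finite A" "x \<in> lin.span (range var)" "x \<notin> U" "x * h \<in> product_ideal (\<lambda>_. U) A W"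
  shows "h \<in> product_ideal (\<lambda>_. U) A W"
proof -
  have "coeff (\<Phi> x) 0 \<noteq> 0"
    using assms(2,3) p_in[of x] by (auto simp: \<Phi>_linear)
  moreover have "Polynomial.monom 1 (card A + 0) dvd \<Phi> x * \<Phi> h"
    using assms(1,4) by (simp add: mem_product_ideal_iff \<Phi>_mult)
  ultimately show ?thesis
    unfolding mem_product_ideal_iff[OF assms(1)] by (rule monom_dvd_cancel)
qed

text \<open>Here \<open>\<Phi> x\<close> is \<open>t\<close> times the nonzero constant \<open>x - q x\<close>, so exactly one factor \<open>t\<close> is
  lost.\<close>

lemma cancel_inside:
  assumes "finite A" "i \<notin> A" "x \<in> U" "x \<notin> W" "x * h \<in> product_ideal (\<lambda>_. U) (insert i A) W"
  shows "h \<in> product_ideal (\<lambda>_. U) A W"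
proof -
  have "coeff (\<Phi> x) 1 \<noteq> 0"
    using assms(3,4) q_in[of x] U_linear p_id by (auto simp: \<Phi>_linear subset_iff)
  moreover have "Polynomial.monom 1 (card A + 1) dvd \<Phi> x * \<Phi> h"
    using assms(1,2,5) by (simp add: mem_product_ideal_iff \<Phi>_mult)
  ultimately show ?thesis
    unfolding mem_product_ideal_iff[OF assms(1)] by (rule monom_dvd_cancel)
qed

text \<open>Not lying in \<open>(U) + (W)\<close> means having order \<open>0\<close>, so \<open>b\<close> contributes nothing to the order of
  \<open>a b\<close>.\<close>

lemma primary:
  assumes "finite A" "a * b \<in> product_ideal (\<lambda>_. U) A W" "b \<notin> product_ideal (\<lambda>_. U) {i} W"
  shows "a \<in> product_ideal (\<lambda>_. U) A W"
proof -
  have "coeff (\<Phi> b) 0 \<noteq> 0"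
    using assms(3) by (auto simp: mem_product_ideal_iff monom_1_dvd_iff')
  moreover have "Polynomial.monom 1 (card A + 0) dvd \<Phi> b * \<Phi> a"
    using assms(1,2) by (simp add: mem_product_ideal_iff \<Phi>_mult mult.commute)
  ultimately show ?thesis
    unfolding mem_product_ideal_iff[OF assms(1)] by (rule monom_dvd_cancel)
qed

lemma one_notin:
  assumes "finite A" "A \<noteq> {}"
  shows "1 \<notin> product_ideal (\<lambda>_. U) A W"
proof -
  have "\<Phi> 1 = 1" using \<Phi>_const[of 1] by (simp add: one_pCons)
  with assms show ?thesis
    by (auto simp: mem_product_ideal_iff monom_1_dvd_iff' card_gt_0_iff)
qed

end

lemma ex_linear_flag:
  assumes "lin.subspace W" "lin.subspace U" "W \<subseteq> U" "U \<subseteq> lin.span (range var)"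
  shows "\<exists>p q. linear_flag W U p q"
proof -
  have *: "\<exists>g. Vector_Spaces.linear (\<lambda>c p. const c * p) (\<lambda>c p. const c * p) g
      \<and> (\<forall>x. g x \<in> V) \<and> (\<forall>x\<in>V. g x = x)" if "lin.subspace V" for V :: "'l::field mpoly set"
  proof -
    interpret pair: vector_space_pair "\<lambda>c p. const c * p :: 'l mpoly" "\<lambda>c p. const c * p :: 'l mpoly" ..
    show ?thesis
      using pair.linear_exists_left_inverse_on[OF lin.linear_id that] by auto
  qed
  from *[OF assms(1)] *[OF assms(2)] show ?thesis
    unfolding linear_flag_def using assms by metis
qed

section \<open>Intersections of powers of linear ideals\<close>

lemma (in vector_space) subspace_avoidance:
  assumes inf: "infinite (UNIV :: 'a set)" and "finite F" and V: "subspace V"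
    and "\<And>U. U \<in> F \<Longrightarrow> subspace U" "\<And>U. U \<in> F \<Longrightarrow> \<not> V \<subseteq> U"
  shows "\<exists>x\<in>V. \<forall>U\<in>F. x \<notin> U"
  using assms(2,4,5)
proof (induction F)
  case empty
  show ?case using V subspace_0 by auto
next
  case (insert U0 F)
  then obtain x where x: "x \<in> V" "\<forall>U\<in>F. x \<notin> U" by auto
  obtain y where y: "y \<in> V" "y \<notin> U0" using insert.prems(2)[of U0] by auto
  show ?case
  proof (cases "x \<in> U0")
    case False
    with x show ?thesis by auto
  next
    case True
    \<comment> \<open>The line \<open>y + c x\<close> misses \<open>U0\<close> and meets every other space in at most one point.\<close>
    have "finite {c. y + c *s x \<in> U}" if U: "U \<in> F" for U
    proof (rule finite_subset)
      have "c = c'" if "y + c *s x \<in> U" "y + c' *s x \<in> U" for c c'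
      proof (rule ccontr)
        assume "c \<noteq> c'"
        have "subspace U" using insert.prems(1) U by simp
        then have "inverse (c - c') *s ((y + c *s x) - (y + c' *s x)) \<in> U"
          using that by (intro subspace_scale subspace_diff)
        also have "(y + c *s x) - (y + c' *s x) = (c - c') *s x"
          by (simp add: scale_left_diff_distrib)
        finally have "x \<in> U" using \<open>c \<noteq> c'\<close> by simp
        with x U show False by blast
      qed
      then show "{c. y + c *s x \<in> U} \<subseteq> {SOME c. y + c *s x \<in> U}"
        by (auto intro: someI2)
    qed simp
    then have "finite (\<Union>U\<in>F. {c. y + c *s x \<in> U})"
      using insert.hyps(1) by blast
    then obtain c where c: "\<forall>U\<in>F. y + c *s x \<notin> U"
      using inf by (metis (mono_tags, lifting) UN_I UNIV_I finite_subset mem_Collect_eq subsetI)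
    have "y + c *s x \<notin> U0"
    proof
      assume "y + c *s x \<in> U0"
      moreover have "c *s x \<in> U0"
        using True insert.prems(1) by (simp add: subspace_scale)
      ultimately have "y + c *s x - c *s x \<in> U0"
        using insert.prems(1) by (intro subspace_diff) auto
      with y show False by simp
    qed
    moreover have "y + c *s x \<in> V"
      using V x y by (intro subspace_add subspace_scale)
    ultimately show ?thesis using c by blast
  qed
qed

text \<open>The Steinitz exchange step relative to \<open>W\<close>.\<close>

lemma (in vector_space) exchange_one:
  assumes "finite B" "x \<in> span (W \<union> B)" "x \<notin> span W"
  shows "\<exists>b\<in>B. b \<in> span (insert x (W \<union> (B - {b})))"
  using assms
proof (induction B)
  case (insert b B)
  show ?case
  proof (cases "x \<in> span (W \<union> B)")
    case True
    with insert obtain b' where b': "b' \<in> B" "b' \<in> span (insert x (W \<union> (B - {b'})))" by auto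
    moreover have "span (insert x (W \<union> (B - {b'}))) \<subseteq> span (insert x (W \<union> (insert b B - {b'})))"
      by (rule span_mono) auto
    ultimately show ?thesis by blast
  next
    case False
    moreover have "x \<in> span (insert b (W \<union> B))"
      using insert.prems(1) by simp
    ultimately have "b \<in> span (insert x (W \<union> B))"
      by (rule in_span_insert[rotated])
    with insert.hyps show ?thesis by auto
  qed
qed simp

text \<open>Adding one linear form \<open>x\<close> to \<open>W\<close> adds the multiples of \<open>x\<close> to the ideal.\<close>

lemma product_ideal_insert_form:
  assumes "f \<in> product_ideal V A (lin.span (insert x W))" "lin.subspace W"
  shows "\<exists>g\<in>product_ideal V A W. \<exists>h. f = g + x * h"
proof -
  let ?J = "{g + x * h |g h. g \<in> product_ideal V A W}"
  have J: "g + x * h \<in> ?J" if "g \<in> product_ideal V A W" for g h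
    using that by blast
  have "product_ideal V A (lin.span (insert x W)) \<subseteq> ?J"
  proof (rule product_ideal_least)
    show "ringmod.subspace ?J"
    proof (rule ringmod.subspaceI)
      show "0 \<in> ?J" using J[of 0 0] by (simp add: product_ideal_zero)
    next
      fix a b assume "a \<in> ?J" "b \<in> ?J"
      then obtain g h g' h' where "a = g + x * h" "b = g' + x * h'"
        "g \<in> product_ideal V A W" "g' \<in> product_ideal V A W" by auto
      then show "a + b \<in> ?J"
        using J[of "g + g'" "h + h'"] by (simp add: product_ideal_add algebra_simps)
    next
      fix c a assume "a \<in> ?J"
      then obtain g h where "a = g + x * h" "g \<in> product_ideal V A W" by auto
      then show "c * a \<in> ?J"
        using J[of "c * g" "c * h"] by (simp add: product_ideal_scale algebra_simps)
    qed
    show "lin.span (insert x W) \<subseteq> ?J"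
    proof
      fix y assume "y \<in> lin.span (insert x W)"
      then obtain k where "y - const k * x \<in> W"
        using assms(2) unfolding lin.span_breakdown_eq
        by (metis lin.span_eq_iff)
      from J[OF product_ideal_base[OF this], of "const k"] show "y \<in> ?J"
        by (simp add: mult.commute)
    qed
    fix v assume "\<And>j. j \<in> A \<Longrightarrow> v j \<in> V j"
    then show "(\<Prod>j\<in>A. v j) \<in> ?J"
      using J[of "\<Prod>j\<in>A. v j" 0] by (simp add: product_ideal_prod)
  qed
  with assms(1) show ?thesis by blast
qed

text \<open>The finite set \<open>B\<close> spans everything modulo \<open>W\<close>; its cardinality bounds the codimension of
  \<open>W\<close> and is the measure of the inner induction.  Working modulo an arbitrary \<open>W\<close> replaces the
  passage to quotient rings.\<close>

lemma Inter_powers_subset_product: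
  fixes S :: "'i \<Rightarrow> 'l::field mpoly set"
  assumes inf: "infinite (UNIV :: 'l set)"
    and "finite D" and "\<And>j. j \<in> D \<Longrightarrow> S j \<subseteq> lin.span (range var)"
    and "lin.subspace W" "W \<subseteq> lin.span (range var)"
    and "finite B" "(\<Union>j\<in>D. S j) \<subseteq> lin.span (W \<union> B)"
    and "\<And>A. A \<subseteq> D \<Longrightarrow> A \<noteq> {} \<Longrightarrow> f \<in> product_ideal (\<lambda>_. lin.span (W \<union> (\<Union>j\<in>A. S j))) A W"
  shows "f \<in> product_ideal S D W"
  using assms(2-)
proof (induction D arbitrary: f W B rule: finite_psubset_induct)
  case (psubset D)
  note outer = psubset.IH and S_linear = psubset.prems(1)
  show ?case
    using psubset.prems(2-)
  proof (induction "card B" arbitrary: f W B rule: less_induct)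
    case less
    note W = less.prems(1,2) and B = less.prems(3,4) and f = less.prems(5)
    define U where "U A = lin.span (W \<union> (\<Union>j\<in>A. S j))" for A
    have f: "f \<in> product_ideal (\<lambda>_. U A) A W" if "A \<subseteq> D" "A \<noteq> {}" for A
      using f[OF that] by (simp add: U_def)
    have finite_sub: "finite A" if "A \<subseteq> D" for A
      using that psubset.hyps finite_subset by blast
    have W_U: "W \<subseteq> U A" for A
      unfolding U_def using lin.span_superset[of "W \<union> (\<Union>j\<in>A. S j)"] by auto
    have S_U: "S j \<subseteq> U A" if "j \<in> A" for j A
      unfolding U_def using that lin.span_superset[of "W \<union> (\<Union>j\<in>A. S j)"] by auto
    have U_mono: "U A \<subseteq> U A'" if "A \<subseteq> A'" for A A'
      unfolding U_def using that by (intro lin.span_mono) auto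
    have U_linear: "U A \<subseteq> lin.span (range var)" if "A \<subseteq> D" for A
      unfolding U_def using W S_linear that by (intro lin.span_minimal) auto
    have subspace_U: "lin.subspace (U A)" for A
      by (simp add: U_def)
    have flag: "\<exists>p q. linear_flag W (U A) p q" if "A \<subseteq> D" for A
      using ex_linear_flag[OF W(1) subspace_U W_U U_linear[OF that]] .
    show ?case
    proof (cases "D = {} \<or> U D \<subseteq> W")
      case True
      show ?thesis
      proof (cases "D = {}")
        case False
        then obtain i where i: "i \<in> D" by auto
        have "product_ideal (\<lambda>_. U D) D W \<subseteq> product_ideal (\<lambda>_. U D) {i} W"
          using i psubset.hyps by (intro product_ideal_antimono) auto
        also have "\<dots> \<subseteq> product_ideal S D W"
          using True False
          by (intro product_ideal_least subspace_product_ideal) (auto intro: product_ideal_base)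
        finally show ?thesis using f[of D] False by auto
      qed simp
    next
      case False
      \<comment> \<open>The space \<open>W = U {}\<close> is among those avoided.\<close>
      have "\<exists>x\<in>U D. \<forall>V\<in>U ` {A. A \<subseteq> D \<and> \<not> U D \<subseteq> U A}. x \<notin> V"
        using subspace_U psubset.hyps by (intro lin.subspace_avoidance[OF inf]) auto
      then obtain x where x: "x \<in> U D" and avoid: "\<And>A. A \<subseteq> D \<Longrightarrow> \<not> U D \<subseteq> U A \<Longrightarrow> x \<notin> U A"
        by auto
      have span_W: "lin.span W = W"
        using W(1) by (simp only: lin.span_eq_iff)
      then have "U {} = W" by (simp add: U_def W(1))
      with avoid[of "{}"] False have "x \<notin> W" by auto
      have "U D \<subseteq> lin.span (W \<union> B)"
        unfolding U_def using B(2) lin.span_superset[of "W \<union> B"] by (intro lin.span_minimal) auto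
      then have "x \<in> lin.span (W \<union> B)" using x by blast
      moreover have "x \<notin> lin.span W" unfolding span_W by (rule \<open>x \<notin> W\<close>)
      ultimately obtain b
        where b: "b \<in> B" "b \<in> lin.span (insert x (W \<union> (B - {b})))"
        using lin.exchange_one[OF B(1)] by blast
      \<comment> \<open>Replacing \<open>b\<close> by \<open>x\<close> in the spanning set and moving \<open>x\<close> into \<open>W\<close> shrinks \<open>B\<close>.\<close>
      define W' where "W' = lin.span (insert x W)"
      have "f \<in> product_ideal S D W'"
      proof (rule less.hyps)
        show "card (B - {b}) < card B"
          using b(1) B(1) by (intro psubset_card_mono) auto
        show "lin.subspace W'" by (simp add: W'_def)
        show "W' \<subseteq> lin.span (range var)"
          unfolding W'_def using x U_linear[of D] W(2) by (intro lin.span_minimal) auto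
        show "finite (B - {b})" using B(1) by simp
        have "W \<union> B \<subseteq> lin.span (insert x (W \<union> (B - {b})))"
          using b(2) lin.span_superset[of "insert x (W \<union> (B - {b}))"] by auto
        then have "lin.span (W \<union> B) \<subseteq> lin.span (insert x (W \<union> (B - {b})))"
          by (intro lin.span_minimal) auto
        also have "\<dots> \<subseteq> lin.span (W' \<union> (B - {b}))"
          unfolding W'_def using lin.span_superset[of "insert x W"] by (intro lin.span_mono) auto
        finally show "(\<Union>j\<in>D. S j) \<subseteq> lin.span (W' \<union> (B - {b}))"
          using B(2) by blast
        have "W \<subseteq> W'"
          unfolding W'_def using lin.span_superset[of "insert x W"] by auto
        then show "f \<in> product_ideal (\<lambda>_. lin.span (W' \<union> (\<Union>j\<in>A. S j))) A W'"
          if "A \<subseteq> D" "A \<noteq> {}" for A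
          using f[OF that] product_ideal_mono[of A "\<lambda>_. U A" "\<lambda>_. lin.span (W' \<union> (\<Union>j\<in>A. S j))" W W']
          by (auto simp: U_def intro: lin.span_mono[THEN subsetD, rotated])
      qed
      then obtain g h where g: "g \<in> product_ideal S D W" and fgh: "f = g + x * h"
        using product_ideal_insert_form W(1) unfolding W'_def by blast
      have xh: "x * h \<in> product_ideal (\<lambda>_. U A) A W" if A: "A \<subseteq> D" "A \<noteq> {}" for A
      proof -
        have "product_ideal S D W \<subseteq> product_ideal S A W"
          using psubset.hyps A(1) by (rule product_ideal_antimono)
        also have "\<dots> \<subseteq> product_ideal (\<lambda>_. U A) A W"
          using S_U by (intro product_ideal_mono) auto
        finally have "f - g \<in> product_ideal (\<lambda>_. U A) A W"
          using g f[OF A] by (intro product_ideal_diff) auto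
        then show ?thesis by (simp add: fgh)
      qed
      have h: "h \<in> product_ideal (\<lambda>_. U A) A W" if A: "A \<subset> D" "A \<noteq> {}" for A
      proof (cases "U D \<subseteq> U A")
        case False
        obtain p q where "linear_flag W (U A) p q"
          using flag[of A] A(1) by auto
        then show ?thesis
          using linear_flag.cancel_outside[of W "U A" p q A x h] xh[of A] A avoid[of A] False
            finite_sub[of A] x U_linear[of D] by auto
      next
        case True
        then have UA: "U A = U D" using U_mono[of A D] A by blast
        \<comment> \<open>Cancelling \<open>x\<close> costs a factor, so the condition for \<open>D\<close> is used, which has at least
          one factor more than the one for \<open>A\<close>.\<close>
        obtain i where i: "i \<in> D" "i \<notin> A" using A by auto
        obtain p q where flag: "linear_flag W (U D) p q"
          using flag[of D] by auto
        have "x * h \<in> product_ideal (\<lambda>_. U D) (insert i A) W"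
          using xh[of D] i A product_ideal_antimono[of D "insert i A"] psubset.hyps by blast
        then show ?thesis
          using linear_flag.cancel_inside[OF flag, of A i x h] i A finite_sub[of A] x \<open>x \<notin> W\<close>
          by (auto simp: UA)
      qed
      have s_h: "s * h \<in> product_ideal S D W" if s: "i \<in> D" "s \<in> S i" for i s
      proof -
        have "h \<in> product_ideal S (D - {i}) W"
        proof (rule outer)
          show "D - {i} \<subset> D" using s by auto
          show "(\<Union>j\<in>D - {i}. S j) \<subseteq> lin.span (W \<union> B)" using B(2) by blast
          show "h \<in> product_ideal (\<lambda>_. lin.span (W \<union> (\<Union>j\<in>A. S j))) A W"
            if "A \<subseteq> D - {i}" "A \<noteq> {}" for A
            using h[of A] that s by (auto simp: U_def)
        qed (use W B S_linear in auto)
        then have "s * h \<in> product_ideal S (insert i (D - {i})) W"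
          using s psubset.hyps by (intro product_ideal_insert) (auto intro: ringmod.span_base)
        with s show ?thesis by (simp add: insert_absorb)
      qed
      have "y * h \<in> product_ideal S D W" if "y \<in> U D" for y
        using that unfolding U_def
      proof (induction rule: lin.span_induct_alt)
        case base
        show ?case by (simp add: product_ideal_zero)
      next
        case (step c y z)
        have "y * h \<in> product_ideal S D W"
        proof (cases "y \<in> W")
          case True
          then show ?thesis
            using product_ideal_scale[OF product_ideal_base, of y W h S D] by (simp add: mult.commute)
        next
          case False
          with step.hyps show ?thesis by (auto intro: s_h)
        qed
        then have "const c * (y * h) + z * h \<in> product_ideal S D W"
          using step.IH by (intro product_ideal_add product_ideal_scale[of "y * h"])
        then show ?case by (simp add: algebra_simps)
      qed
      with x g show ?thesis
        unfolding fgh by (intro product_ideal_add)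
    qed
  qed
qed

section \<open>Extension to an infinite field\<close>

lemma infinite_fls: "infinite (UNIV :: 'k::field fls set)"
proof -
  have "inj (\<lambda>n. fls_X ^ n :: 'k fls)"
  proof (rule injI)
    fix i j assume "fls_X ^ i = (fls_X ^ j :: 'k fls)"
    then have "fls_nth (fls_X ^ i :: 'k fls) (int i) = fls_nth (fls_X ^ j) (int i)" by simp
    then show "i = j" by (simp split: if_splits)
  qed
  from range_inj_infinite[OF this] show ?thesis
    by (rule infinite_super[OF subset_UNIV])
qed

text \<open>Laurent series serve as an infinite extension field in which the constant coefficient is a linear
  projection back to the base field.\<close>

definition embed :: "'k::field mpoly \<Rightarrow> 'k fls mpoly" where
  "embed = evaluate (\<lambda>c. const (fls_const c)) var"

interpretation embed: coefficient_hom "\<lambda>c::'k::field. const (fls_const c)"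
  by unfold_locales (simp_all add: mult_single fls_plus_const flip: single_add)

lemma embed_add: "embed (p + q) = embed p + embed q"
  and embed_mult: "embed (p * q) = embed p * embed q"
  and embed_prod: "embed (\<Prod>j\<in>A. v j) = (\<Prod>j\<in>A. embed (v j))"
  and embed_0 [simp]: "embed 0 = 0"
  and embed_1 [simp]: "embed 1 = 1"
  by (simp_all add: embed_def embed.evaluate_add embed.evaluate_mult embed.evaluate_prod)

lemma evaluate_monom_var: "evaluate_monom var m = (Poly_Mapping.single m 1 :: 'k::comm_ring_1 mpoly)"
  by (induction m rule: poly_mapping_single_induct)
    (simp_all add: evaluate_monom_add mult_single var_power)

lemma embed_single: "embed (Poly_Mapping.single m c) = Poly_Mapping.single m (fls_const c)"
  by (simp add: embed_def evaluate_monom_var mult_single)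

text \<open>Not a ring homomorphism, but linear over the ring in the variables \<open>1, \<dots>, n\<close> and a left inverse
  of \<open>embed\<close> there.\<close>

definition retract :: "nat \<Rightarrow> 'k::field fls mpoly \<Rightarrow> 'k mpoly" where
  "retract n = Poly_Mapping.mapp (\<lambda>m c. if Poly_Mapping.keys m \<subseteq> {1..n} then fls_nth c 0 else 0)"

lemma lookup_retract:
  "Poly_Mapping.lookup (retract n F) m
    = (if Poly_Mapping.keys m \<subseteq> {1..n} then fls_nth (Poly_Mapping.lookup F m) 0 else 0)"
  by (auto simp: retract_def lookup_mapp when_def in_keys_iff)

lemma retract_add: "retract n (F + G) = retract n F + retract n G"
  by (rule poly_mapping_eqI) (simp add: lookup_retract lookup_add)

lemma retract_0 [simp]: "retract n 0 = 0"
  by (rule poly_mapping_eqI) (simp add: lookup_retract)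

lemma retract_single:
  "retract n (Poly_Mapping.single m c)
    = (if Poly_Mapping.keys m \<subseteq> {1..n} then Poly_Mapping.single m (fls_nth c 0) else 0)"
  by (rule poly_mapping_eqI) (auto simp: lookup_retract lookup_single when_def)

lemma carrier_poly_ring:
  "p \<in> carrier (poly_ring n) \<longleftrightarrow> (\<forall>m\<in>Poly_Mapping.keys p. Poly_Mapping.keys m \<subseteq> {1..n})"
  by (simp add: poly_ring_def)

lemma poly_ring_ops [simp]:
  "x \<oplus>\<^bsub>poly_ring n\<^esub> y = x + y" "x \<otimes>\<^bsub>poly_ring n\<^esub> y = x * y"
  "\<zero>\<^bsub>poly_ring n\<^esub> = 0" "\<one>\<^bsub>poly_ring n\<^esub> = 1"
  by (simp_all add: poly_ring_def)

lemma linear_forms_carrier: "linear_forms n \<subseteq> carrier (poly_ring n)"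
  by (auto simp: linear_forms_def)

lemma retract_carrier: "retract n F \<in> carrier (poly_ring n)"
  unfolding carrier_poly_ring by (metis in_keys_iff lookup_retract)

lemma keys_nat_add: "Poly_Mapping.keys (m + m') = Poly_Mapping.keys m \<union> Poly_Mapping.keys (m' :: 'a \<Rightarrow>\<^sub>0 nat)"
  by (auto simp: in_keys_iff lookup_add)

lemma retract_single_mult:
  assumes "Poly_Mapping.keys m \<subseteq> {1..n}"
  shows "retract n (Poly_Mapping.single m (fls_const c) * F) = Poly_Mapping.single m c * retract n F"
proof (induction F rule: poly_mapping_single_induct)
  case (single m' c')
  show ?case using assms by (simp add: mult_single retract_single keys_nat_add)
qed (simp_all add: retract_add distrib_left)

lemma retract_embed_mult:
  assumes "p \<in> carrier (poly_ring n)"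
  shows "retract n (embed p * F) = p * retract n F"
proof -
  have "retract n (embed (\<Sum>m\<in>A. Poly_Mapping.single m (Poly_Mapping.lookup p m)) * F)
      = (\<Sum>m\<in>A. Poly_Mapping.single m (Poly_Mapping.lookup p m)) * retract n F"
    if "finite A" "\<forall>m\<in>A. Poly_Mapping.keys m \<subseteq> {1..n}" for A
    using that
    by induction (simp_all add: embed_add embed_single retract_add retract_single_mult distrib_right)
  from this[of "Poly_Mapping.keys p"] assms show ?thesis
    by (simp add: carrier_poly_ring flip: poly_mapping_sum_single)
qed

lemma retract_embed:
  assumes "p \<in> carrier (poly_ring n)"
  shows "retract n (embed p) = p"
proof -
  have "retract n (1 :: 'a fls mpoly) = 1"
    using retract_single[of n 0 "1 :: 'a fls"] by simp
  with retract_embed_mult[OF assms, of 1] show ?thesis by simp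
qed

lemma embed_linear_form:
  assumes "p \<in> linear_forms n"
  shows "embed p \<in> lin.span (var ` {1..n})"
proof -
  have m: "Poly_Mapping.single m (fls_const (Poly_Mapping.lookup p m)) \<in> lin.span (var ` {1..n})"
    if "m \<in> Poly_Mapping.keys p" for m
  proof -
    have deg: "(\<Sum>i\<in>Poly_Mapping.keys m. Poly_Mapping.lookup m i) = 1" and sub: "Poly_Mapping.keys m \<subseteq> {1..n}"
      using that assms by (auto simp: linear_forms_def homogeneous_def monom_deg_def carrier_poly_ring)
    then obtain i where i: "i \<in> Poly_Mapping.keys m" "Poly_Mapping.lookup m i = 1"
      "\<And>j. j \<in> Poly_Mapping.keys m \<Longrightarrow> i \<noteq> j \<Longrightarrow> Poly_Mapping.lookup m j = 0"
      by (auto simp: sum_eq_Suc0_iff)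
    then have "m = Poly_Mapping.single i 1"
      by (intro poly_mapping_eqI) (auto simp: lookup_single when_def in_keys_iff)
    moreover have "Poly_Mapping.single (Poly_Mapping.single i 1) c = const c * var i" for c :: "'a fls"
      by (simp add: var_def mult_single)
    moreover have "const c * var i \<in> lin.span (var ` {1..n})" for c :: "'a fls"
      using i(1) sub by (intro lin.span_scale lin.span_base) blast
    ultimately show ?thesis by metis
  qed
  have "embed (\<Sum>m\<in>A. Poly_Mapping.single m (Poly_Mapping.lookup p m)) \<in> lin.span (var ` {1..n})"
    if "finite A" "A \<subseteq> Poly_Mapping.keys p" for A
    using that
  proof induction
    case (insert m A)
    then have "embed (Poly_Mapping.single m (Poly_Mapping.lookup p m))
        + embed (\<Sum>m\<in>A. Poly_Mapping.single m (Poly_Mapping.lookup p m)) \<in> lin.span (var ` {1..n})"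
      unfolding embed_single by (intro lin.span_add m) auto
    with insert.hyps show ?case by (simp add: embed_add)
  qed (simp add: lin.span_zero)
  from this[of "Poly_Mapping.keys p"] show ?thesis
    by (simp flip: poly_mapping_sum_single)
qed

text \<open>The retraction maps a combination of images of elements of \<open>J\<close>, with coefficients in the
  extended ring, to a combination of the same elements with coefficients in the original ring.\<close>

lemma retract_mem_ideal:
  assumes J: "ideal J (poly_ring n)" and G: "G \<subseteq> J" and F: "F \<in> ringmod.span (embed ` G)"
  shows "retract n F \<in> J"
  using F
proof (induction rule: ringmod.span_induct_alt)
  case base
  show ?case
    using J by (simp add: additive_subgroup.zero_closed[OF ideal.axioms(1), of J "poly_ring n", simplified])
next
  case (step c x y)
  then obtain g where g: "x = embed g" "g \<in> J" using G by auto
  have "retract n (c * x + y) = g * retract n c + retract n y"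
    using ideal.Icarr[OF J g(2)] g(1) by (simp add: retract_add mult.commute[of c] retract_embed_mult)
  moreover have "g * retract n c \<in> J"
    using ideal.I_r_closed[OF J g(2) retract_carrier] by simp
  ultimately show ?case
    using step.IH additive_subgroup.a_closed[OF ideal.axioms(1)[OF J]] by simp
qed

lemma ideal_embed_preimage:
  assumes "ringmod.subspace J"
  shows "ideal {f \<in> carrier (poly_ring n). embed f \<in> J} (poly_ring n)"
proof -
  interpret R: cring "poly_ring n :: 'a mpoly ring" by (rule cring_poly_ring)
  have uminus: "\<ominus>\<^bsub>poly_ring n\<^esub> f = - f" if "f \<in> carrier (poly_ring n)" for f :: "'a mpoly"
    using that by (intro R.minus_equality) (auto simp: carrier_poly_ring)
  have embed_uminus: "embed (- f) = - embed f" for f :: "'a mpoly"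
    using embed_add[of f "- f"] by (simp add: eq_neg_iff_add_eq_0 add.commute)
  note closed = R.add.m_closed[simplified] R.m_closed[simplified]
  show ?thesis
  proof (rule idealI)
    show "ring (poly_ring n :: 'a mpoly ring)" by (rule R.ring_axioms)
    show "subgroup {f \<in> carrier (poly_ring n). embed f \<in> J} (add_monoid (poly_ring n))"
    proof (rule R.add.subgroupI)
      show "{f \<in> carrier (poly_ring n). embed f \<in> J} \<noteq> {}"
        using assms R.zero_closed by (auto simp: ringmod.subspace_0 intro!: exI[of _ 0])
      fix a assume "a \<in> {f \<in> carrier (poly_ring n). embed f \<in> J}"
      then show "\<ominus>\<^bsub>poly_ring n\<^esub> a \<in> {f \<in> carrier (poly_ring n). embed f \<in> J}"
        using R.a_inv_closed[of a] assms by (simp add: uminus embed_uminus ringmod.subspace_neg)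
    qed (use assms closed in \<open>auto simp: embed_add ringmod.subspace_add\<close>)
  qed (use assms closed ringmod.subspace_scale[OF assms] in \<open>auto simp: embed_mult mult.commute\<close>)
qed

lemma embed_Idl:
  assumes "S \<subseteq> carrier (poly_ring n)" "f \<in> Idl\<^bsub>poly_ring n\<^esub> S"
  shows "embed f \<in> ringmod.span (embed ` S)"
proof -
  interpret R: cring "poly_ring n :: 'a mpoly ring" by (rule cring_poly_ring)
  have "Idl\<^bsub>poly_ring n\<^esub> S \<subseteq> {f \<in> carrier (poly_ring n). embed f \<in> ringmod.span (embed ` S)}"
    using assms(1) by (intro R.genideal_minimal ideal_embed_preimage) (auto intro: ringmod.span_base)
  with assms(2) show ?thesis by blast
qed

section \<open>Products and sums of ideals of the polynomial ring\<close>

lemma ideals_set_ops [simp]: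
  "carrier (ideals_set R) = {I. ideal I R}" "\<one>\<^bsub>ideals_set R\<^esub> = carrier R" "\<zero>\<^bsub>ideals_set R\<^esub> = {\<zero>\<^bsub>R\<^esub>}"
  "I \<otimes>\<^bsub>ideals_set R\<^esub> J = ideal_prod R I J" "I \<oplus>\<^bsub>ideals_set R\<^esub> J = I <+>\<^bsub>R\<^esub> J"
  by (simp_all add: ideals_set_def)

lemma prod_mem_finprod:
  fixes J :: "'i \<Rightarrow> 'k::field mpoly set"
  assumes "finite A" "\<And>j. j \<in> A \<Longrightarrow> ideal (J j) (poly_ring n)" "\<And>j. j \<in> A \<Longrightarrow> s j \<in> J j"
  shows "(\<Prod>j\<in>A. s j) \<in> (\<Otimes>\<^bsub>ideals_set (poly_ring n)\<^esub>j\<in>A. J j)"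
proof -
  interpret R: cring "poly_ring n :: 'k mpoly ring" by (rule cring_poly_ring)
  interpret M: comm_monoid "ideals_set (poly_ring n :: 'k mpoly ring)"
    by (rule R.ideals_set_is_comm_monoid)
  show ?thesis
    using assms
  proof (induction A)
    case empty
    show ?case using R.one_closed by simp
  next
    case (insert j A)
    then have "s j \<otimes>\<^bsub>poly_ring n\<^esub> (\<Prod>j\<in>A. s j) \<in> ideal_prod (poly_ring n) (J j) (\<Otimes>\<^bsub>ideals_set (poly_ring n)\<^esub>j\<in>A. J j)"
      by (intro ideal_prod.prod) auto
    with insert show ?case by (simp add: M.finprod_insert Pi_def)
  qed
qed

text \<open>Products of ideals are tested after extension.  From right to left, an element of the extended
  product is a combination of images of products of generators, and \<open>retract\<close> turns it into such a
  combination over the original ring.\<close>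

lemma mem_finprod_Idl_iff:
  fixes S :: "'i \<Rightarrow> 'k::field mpoly set"
  assumes "finite A" "\<And>j. j \<in> A \<Longrightarrow> S j \<subseteq> carrier (poly_ring n)"
  shows "f \<in> (\<Otimes>\<^bsub>ideals_set (poly_ring n)\<^esub>j\<in>A. Idl\<^bsub>poly_ring n\<^esub> (S j))
    \<longleftrightarrow> f \<in> carrier (poly_ring n) \<and> embed f \<in> product_ideal (\<lambda>j. embed ` S j) A {}"
proof -
  interpret R: cring "poly_ring n :: 'k mpoly ring" by (rule cring_poly_ring)
  interpret M: comm_monoid "ideals_set (poly_ring n :: 'k mpoly ring)"
    by (rule R.ideals_set_is_comm_monoid)
  let ?P = "\<lambda>A. \<Otimes>\<^bsub>ideals_set (poly_ring n)\<^esub>j\<in>A. Idl\<^bsub>poly_ring n\<^esub> (S j)"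
  have ideal: "ideal (Idl\<^bsub>poly_ring n\<^esub> (S j)) (poly_ring n)" if "j \<in> A" for j
    using assms(2)[OF that] by (rule R.genideal_ideal)
  have "(\<lambda>j. Idl\<^bsub>poly_ring n\<^esub> (S j)) \<in> A \<rightarrow> carrier (ideals_set (poly_ring n))"
    using ideal by auto
  then have ideal_P: "ideal (?P A) (poly_ring n)"
    using M.finprod_closed by fastforce
  show ?thesis
  proof (intro iffI conjI; (elim conjE)?)
    assume "f \<in> ?P A"
    then show "f \<in> carrier (poly_ring n)" by (rule ideal.Icarr[OF ideal_P])
    show "embed f \<in> product_ideal (\<lambda>j. embed ` S j) A {}"
      using assms(1) \<open>f \<in> ?P A\<close> assms(2) ideal
    proof (induction A arbitrary: f)
      case (insert j A)
      have "f \<in> ideal_prod (poly_ring n) (Idl\<^bsub>poly_ring n\<^esub> (S j)) (?P A)"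
        using insert.prems insert.hyps by (simp add: M.finprod_insert Pi_def)
      then show ?case
      proof induction
        case (prod a b)
        then show ?case
          using insert embed_Idl[of "S j" n a]
          by (simp add: embed_mult product_ideal_insert)
      next
        case (sum a b)
        then show ?case by (simp add: embed_add product_ideal_add)
      qed
    qed simp
  next
    assume f: "f \<in> carrier (poly_ring n)" and "embed f \<in> product_ideal (\<lambda>j. embed ` S j) A {}"
    let ?G = "{\<Prod>j\<in>A. s j |s. \<forall>j\<in>A. s j \<in> S j}"
    have "{\<Prod>j\<in>A. v j |v. \<forall>j\<in>A. v j \<in> embed ` S j} \<subseteq> embed ` ?G"
    proof
      fix x assume "x \<in> {\<Prod>j\<in>A. v j |v. \<forall>j\<in>A. v j \<in> embed ` S j}"
      then obtain v where v: "x = (\<Prod>j\<in>A. v j)" "\<forall>j\<in>A. v j \<in> embed ` S j" by auto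
      then have "\<forall>j\<in>A. \<exists>s. s \<in> S j \<and> v j = embed s" by blast
      then obtain s where s: "\<forall>j\<in>A. s j \<in> S j \<and> v j = embed (s j)" by metis
      then have "x = embed (\<Prod>j\<in>A. s j)" by (simp add: v(1) embed_prod)
      with s show "x \<in> embed ` ?G" by blast
    qed
    then have "embed f \<in> ringmod.span (embed ` ?G)"
      using \<open>embed f \<in> _\<close> ringmod.span_mono[of _ "embed ` ?G"]
      unfolding product_ideal_def Un_empty_right by blast
    moreover have "?G \<subseteq> ?P A"
    proof clarify
      fix s assume s: "\<forall>j\<in>A. s j \<in> S j"
      show "(\<Prod>j\<in>A. s j) \<in> ?P A"
      proof (rule prod_mem_finprod[OF assms(1) ideal])
        fix j assume "j \<in> A"
        with s R.genideal_self[OF assms(2)] show "s j \<in> Idl\<^bsub>poly_ring n\<^esub> (S j)" by blast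
      qed
    qed
    ultimately have "retract n (embed f) \<in> ?P A"
      by (intro retract_mem_ideal[OF ideal_P])
    with f show "f \<in> ?P A" by (simp add: retract_embed)
  qed
qed

lemma finsum_Idl:
  fixes S :: "'i \<Rightarrow> 'k::field mpoly set"
  assumes "finite A" "\<And>j. j \<in> A \<Longrightarrow> S j \<subseteq> carrier (poly_ring n)"
  shows "(\<Oplus>\<^bsub>ideals_set (poly_ring n)\<^esub>j\<in>A. Idl\<^bsub>poly_ring n\<^esub> (S j)) = Idl\<^bsub>poly_ring n\<^esub> (\<Union>j\<in>A. S j)"
proof -
  interpret R: cring "poly_ring n :: 'k mpoly ring" by (rule cring_poly_ring)
  interpret M: semiring "ideals_set (poly_ring n :: 'k mpoly ring)"
    by (rule R.ideals_set_is_semiring)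
  show ?thesis
    using assms
  proof (induction A)
    case empty
    have "Idl\<^bsub>poly_ring n\<^esub> {} = {0 :: 'k mpoly}"
      using R.genideal_minimal[OF R.zeroideal, of "{}"]
        additive_subgroup.zero_closed[OF ideal.axioms(1)[OF R.genideal_ideal[of "{}"]]] by auto
    then show ?case by simp
  next
    case (insert j A)
    let ?X = "S j" and ?Y = "\<Union>j\<in>A. S j"
    have XY: "?X \<subseteq> carrier (poly_ring n)" "?Y \<subseteq> carrier (poly_ring n)" "?X \<union> ?Y \<subseteq> carrier (poly_ring n)"
      using insert.prems by auto
    have "(\<Oplus>\<^bsub>ideals_set (poly_ring n)\<^esub>j\<in>insert j A. Idl\<^bsub>poly_ring n\<^esub> (S j))
        = Idl\<^bsub>poly_ring n\<^esub> ?X <+>\<^bsub>poly_ring n\<^esub> Idl\<^bsub>poly_ring n\<^esub> ?Y"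
      using insert R.genideal_ideal by (subst M.finsum_insert) (auto simp: Pi_def)
    also have "\<dots> = Idl\<^bsub>poly_ring n\<^esub> (Idl\<^bsub>poly_ring n\<^esub> ?X \<union> Idl\<^bsub>poly_ring n\<^esub> ?Y)"
      using XY by (intro R.union_genideal[symmetric] R.genideal_ideal)
    also have "\<dots> = Idl\<^bsub>poly_ring n\<^esub> (?X \<union> ?Y)"
    proof (intro antisym R.genideal_minimal)
      have "ideal (Idl\<^bsub>poly_ring n\<^esub> ?X) (poly_ring n)" "ideal (Idl\<^bsub>poly_ring n\<^esub> ?Y) (poly_ring n)"
        using XY R.genideal_ideal by auto
      then have sub: "Idl\<^bsub>poly_ring n\<^esub> ?X \<union> Idl\<^bsub>poly_ring n\<^esub> ?Y \<subseteq> carrier (poly_ring n)"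
        by (auto dest: ideal.Icarr)
      then show "ideal (Idl\<^bsub>poly_ring n\<^esub> (Idl\<^bsub>poly_ring n\<^esub> ?X \<union> Idl\<^bsub>poly_ring n\<^esub> ?Y)) (poly_ring n)"
        by (rule R.genideal_ideal)
      show "ideal (Idl\<^bsub>poly_ring n\<^esub> (?X \<union> ?Y)) (poly_ring n)"
        using XY(3) by (rule R.genideal_ideal)
      show "Idl\<^bsub>poly_ring n\<^esub> ?X \<union> Idl\<^bsub>poly_ring n\<^esub> ?Y \<subseteq> Idl\<^bsub>poly_ring n\<^esub> (?X \<union> ?Y)"
        using R.subset_Idl_subset[OF XY(3)] by auto
      show "?X \<union> ?Y \<subseteq> Idl\<^bsub>poly_ring n\<^esub> (Idl\<^bsub>poly_ring n\<^esub> ?X \<union> Idl\<^bsub>poly_ring n\<^esub> ?Y)"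
        using R.genideal_self[OF sub] R.genideal_self[OF XY(1)] R.genideal_self[OF XY(2)] by blast
    qed
    finally show ?case by simp
  qed
qed

text \<open>The form in which powers meet the valuation, for the flag \<open>0 \<subseteq> U\<close>.\<close>

lemma mem_Idl_power_iff:
  fixes S :: "'k::field mpoly set"
  assumes A: "finite A" and S: "S \<subseteq> carrier (poly_ring n)"
  shows "f \<in> Idl\<^bsub>poly_ring n\<^esub> S [^]\<^bsub>ideals_set (poly_ring n)\<^esub> card A
    \<longleftrightarrow> f \<in> carrier (poly_ring n) \<and> embed f \<in> product_ideal (\<lambda>_. lin.span (embed ` S)) A {0}"
proof -
  interpret R: cring "poly_ring n :: 'k mpoly ring" by (rule cring_poly_ring)
  interpret M: comm_monoid "ideals_set (poly_ring n :: 'k mpoly ring)"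
    by (rule R.ideals_set_is_comm_monoid)
  have "product_ideal (\<lambda>_. lin.span (embed ` S)) A {0} \<subseteq> product_ideal (\<lambda>_. embed ` S) A {0}"
    using A lin_span_subset_ideal by (intro product_ideal_span)
  also have "\<dots> \<subseteq> product_ideal (\<lambda>_. embed ` S) A {}"
    by (intro product_ideal_least subspace_product_ideal) (auto intro: product_ideal_zero product_ideal_prod)
  finally have "product_ideal (\<lambda>_. embed ` S) A {} = product_ideal (\<lambda>_. lin.span (embed ` S)) A {0}"
    using product_ideal_mono[of A "\<lambda>_. embed ` S" "\<lambda>_. lin.span (embed ` S)" "{}" "{0}"]
    by (auto intro: lin.span_base)
  moreover have "(\<Otimes>\<^bsub>ideals_set (poly_ring n)\<^esub>j\<in>A. Idl\<^bsub>poly_ring n\<^esub> S)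
      = Idl\<^bsub>poly_ring n\<^esub> S [^]\<^bsub>ideals_set (poly_ring n)\<^esub> card A"
    using R.genideal_ideal[OF S] by (intro M.finprod_const) simp
  ultimately show ?thesis
    using mem_finprod_Idl_iff[OF A, of "\<lambda>_. S" n f] S by simp
qed

text \<open>If \<open>a b \<in> (S)\<^sup>k\<close> and \<open>b \<in> (S)\<close> then \<open>b\<^sup>k \<in> (S)\<^sup>k\<close>; if \<open>b \<notin> (S)\<close> then \<open>b\<close> has
  order \<open>0\<close> and \<open>a \<in> (S)\<^sup>k\<close>.\<close>

lemma primaryideal_Idl_power:
  fixes S :: "'k::field mpoly set"
  assumes A: "finite A" "A \<noteq> {}" and S: "S \<subseteq> linear_forms n"
  shows "primaryideal (Idl\<^bsub>poly_ring n\<^esub> S [^]\<^bsub>ideals_set (poly_ring n)\<^esub> card A) (poly_ring n)"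
proof -
  interpret R: cring "poly_ring n :: 'k mpoly ring" by (rule cring_poly_ring)
  interpret M: comm_monoid "ideals_set (poly_ring n :: 'k mpoly ring)"
    by (rule R.ideals_set_is_comm_monoid)
  let ?P = "Idl\<^bsub>poly_ring n\<^esub> S" and ?U = "lin.span (embed ` S)"
  let ?Q = "?P [^]\<^bsub>ideals_set (poly_ring n)\<^esub> card A"
  have S_carrier: "S \<subseteq> carrier (poly_ring n)"
    using S linear_forms_carrier by blast
  note P = R.genideal_ideal[OF S_carrier]
  have Q: "ideal ?Q (poly_ring n)"
    using M.nat_pow_closed[of ?P] P by simp
  have "?U \<subseteq> lin.span (range var)"
    using S embed_linear_form lin.span_mono[of "var ` {1..n}" "range var"]
    by (intro lin.span_minimal) auto
  then obtain p q where flag: "linear_flag {0} ?U p q"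
    using ex_linear_flag[of "{0}" ?U] by (auto simp: lin.span_zero)
  note Q_iff = mem_Idl_power_iff[OF A(1) S_carrier]
  show ?thesis
  proof (intro primaryideal.intro primaryideal_axioms.intro)
    show "carrier (poly_ring n) \<noteq> ?Q"
      using R.one_closed linear_flag.one_notin[OF flag A] Q_iff[of 1] by auto
  next
    fix a b :: "'k mpoly"
    assume ab: "a \<in> carrier (poly_ring n)" "b \<in> carrier (poly_ring n)" "a \<otimes>\<^bsub>poly_ring n\<^esub> b \<in> ?Q"
    show "a \<in> ?Q \<or> (\<exists>k>0. b [^]\<^bsub>poly_ring n\<^esub> (k::nat) \<in> ?Q)"
    proof (cases "embed b \<in> product_ideal (\<lambda>_. ?U) {0::nat} {0}")
      case True
      have "?P [^]\<^bsub>ideals_set (poly_ring n)\<^esub> card {0::nat} = ?P"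
        using M.l_one[of ?P] P by (simp del: ideals_set_ops(4) ideals_set_ops(2))
      with True have b: "b \<in> ?P"
        using mem_Idl_power_iff[of "{0::nat}" S n b] S_carrier ab(2) by blast
      have "(\<Prod>j\<in>A. b) \<in> (\<Otimes>\<^bsub>ideals_set (poly_ring n)\<^esub>j\<in>A. ?P)"
        using A(1) P b by (intro prod_mem_finprod)
      moreover have "b [^]\<^bsub>poly_ring n\<^esub> k = b ^ k" for k :: nat
        by (induction k) (simp_all add: mult.commute)
      ultimately have "b [^]\<^bsub>poly_ring n\<^esub> card A \<in> ?Q"
        using M.finprod_const[of ?P A] P by simp
      moreover have "card A > 0" using A by (simp add: card_gt_0_iff)
      ultimately show ?thesis by blast
    next
      case False
      with ab show ?thesis
        using linear_flag.primary[OF flag A(1), of "embed a" "embed b" 0] Q_iff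
        by (auto simp: embed_mult)
    qed
  qed (use Q R.cring_axioms in auto)
qed

section \<open>The primary decomposition\<close>

theorem lemma3p2:
  fixes n d :: nat
    and I :: "nat \<Rightarrow> ('k::field) mpoly set"
    and R :: "'k mpoly ring"
    and I_sum :: "nat set \<Rightarrow> 'k mpoly set"
  defines "R \<equiv> poly_ring n"
    and "I_sum \<equiv> (\<lambda>A. \<Oplus>\<^bsub>ideals_set R\<^esub>j\<in>A. I j)"
  assumes "d \<ge> 1"
    and "\<And>j. j \<in> {1..d} \<Longrightarrow> ideal (I j) R"
    and "\<And>j. j \<in> {1..d} \<Longrightarrow> I j \<noteq> {\<zero>\<^bsub>R\<^esub>}"
    and "\<And>j. j \<in> {1..d} \<Longrightarrow> generated_by_linear_forms n (I j)"
  shows "(\<Otimes>\<^bsub>ideals_set R\<^esub>j\<in>{1..d}. I j)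
      = (\<Inter>A\<in>{A. A \<noteq> {} \<and> A \<subseteq> {1..d}}. I_sum A [^]\<^bsub>ideals_set R\<^esub> card A)
    \<and> (\<forall>A. A \<noteq> {} \<and> A \<subseteq> {1..d} \<longrightarrow> primaryideal (I_sum A [^]\<^bsub>ideals_set R\<^esub> card A) R)"
proof -
  interpret R: cring "poly_ring n :: 'k mpoly ring" by (rule cring_poly_ring)
  interpret M: comm_monoid "ideals_set (poly_ring n :: 'k mpoly ring)"
    by (rule R.ideals_set_is_comm_monoid)
  interpret N: semiring "ideals_set (poly_ring n :: 'k mpoly ring)"
    by (rule R.ideals_set_is_semiring)
  have "\<forall>j\<in>{1..d}. \<exists>S. S \<subseteq> linear_forms n \<and> I j = Idl\<^bsub>poly_ring n\<^esub> S"
  proof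
    fix j assume "j \<in> {1..d}"
    from assms(6)[OF this] show "\<exists>S. S \<subseteq> linear_forms n \<and> I j = Idl\<^bsub>poly_ring n\<^esub> S"
      unfolding generated_by_linear_forms_def by blast
  qed
  then obtain S where S: "\<And>j. j \<in> {1..d} \<Longrightarrow> S j \<subseteq> linear_forms n"
    and I: "\<And>j. j \<in> {1..d} \<Longrightarrow> I j = Idl\<^bsub>poly_ring n\<^esub> (S j)" by metis
  have S_carrier: "S j \<subseteq> carrier (poly_ring n)" if "j \<in> {1..d}" for j
    using S[OF that] linear_forms_carrier by blast
  have ideal_S: "ideal (Idl\<^bsub>poly_ring n\<^esub> (S j)) (poly_ring n)" if "j \<in> {1..d}" for j
    using S_carrier[OF that] by (rule R.genideal_ideal)
  have fin: "finite A" if "A \<subseteq> {1..d}" for A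
    using that finite_subset by blast
  have I_sum: "I_sum A = Idl\<^bsub>poly_ring n\<^esub> (\<Union>j\<in>A. S j)" if A: "A \<subseteq> {1..d}" for A
  proof -
    have "I_sum A = (\<Oplus>\<^bsub>ideals_set (poly_ring n)\<^esub>j\<in>A. Idl\<^bsub>poly_ring n\<^esub> (S j))"
      unfolding I_sum_def R_def using A ideal_S I by (intro N.finsum_cong') auto
    also have "\<dots> = Idl\<^bsub>poly_ring n\<^esub> (\<Union>j\<in>A. S j)"
      using A fin[OF A] S_carrier by (intro finsum_Idl) blast+
    finally show ?thesis .
  qed
  have prod: "(\<Otimes>\<^bsub>ideals_set R\<^esub>j\<in>{1..d}. I j)
      = (\<Otimes>\<^bsub>ideals_set (poly_ring n)\<^esub>j\<in>{1..d}. Idl\<^bsub>poly_ring n\<^esub> (S j))"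
    unfolding R_def using ideal_S I by (intro M.finprod_cong') auto
  let ?U = "\<lambda>A. lin.span (embed ` (\<Union>j\<in>A. S j))"
  have power_iff: "f \<in> I_sum A [^]\<^bsub>ideals_set R\<^esub> card A
      \<longleftrightarrow> f \<in> carrier (poly_ring n) \<and> embed f \<in> product_ideal (\<lambda>_. ?U A) A {0}"
    if A: "A \<subseteq> {1..d}" for A f
    unfolding I_sum[OF A] R_def using A S_carrier fin[OF A] by (intro mem_Idl_power_iff UN_least) blast+
  have prod_iff: "f \<in> (\<Otimes>\<^bsub>ideals_set R\<^esub>j\<in>{1..d}. I j)
      \<longleftrightarrow> f \<in> carrier (poly_ring n) \<and> embed f \<in> product_ideal (\<lambda>j. embed ` S j) {1..d} {}" for f
    unfolding prod using S_carrier by (intro mem_finprod_Idl_iff) auto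
  have linear: "embed ` S j \<subseteq> lin.span (var ` {1..n})" if "j \<in> {1..d}" for j
    using S[OF that] embed_linear_form by blast
  have "f \<in> (\<Otimes>\<^bsub>ideals_set R\<^esub>j\<in>{1..d}. I j)
      \<longleftrightarrow> f \<in> (\<Inter>A\<in>{A. A \<noteq> {} \<and> A \<subseteq> {1..d}}. I_sum A [^]\<^bsub>ideals_set R\<^esub> card A)" for f
  proof
    assume f: "f \<in> (\<Otimes>\<^bsub>ideals_set R\<^esub>j\<in>{1..d}. I j)"
    have "embed f \<in> product_ideal (\<lambda>_. ?U A) A {0}" if A: "A \<subseteq> {1..d}" for A
    proof -
      have "product_ideal (\<lambda>j. embed ` S j) {1..d} {} \<subseteq> product_ideal (\<lambda>j. embed ` S j) A {}"
        using A by (intro product_ideal_antimono) auto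
      also have "\<dots> \<subseteq> product_ideal (\<lambda>_. ?U A) A {0}"
        by (intro product_ideal_mono) (auto intro: lin.span_base)
      finally show ?thesis using f[unfolded prod_iff] by blast
    qed
    with f show "f \<in> (\<Inter>A\<in>{A. A \<noteq> {} \<and> A \<subseteq> {1..d}}. I_sum A [^]\<^bsub>ideals_set R\<^esub> card A)"
      using power_iff prod_iff by blast
  next
    assume "f \<in> (\<Inter>A\<in>{A. A \<noteq> {} \<and> A \<subseteq> {1..d}}. I_sum A [^]\<^bsub>ideals_set R\<^esub> card A)"
    then have f: "f \<in> I_sum A [^]\<^bsub>ideals_set R\<^esub> card A" if "A \<subseteq> {1..d}" "A \<noteq> {}" for A
      using that by blast
    have "embed f \<in> product_ideal (\<lambda>j. embed ` S j) {1..d} {0}"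
    proof (rule Inter_powers_subset_product[OF infinite_fls])
      show "embed ` S j \<subseteq> lin.span (range var)" if "j \<in> {1..d}" for j
        using linear[OF that] lin.span_mono[of "var ` {1..n}" "range var"] by blast
      show "(\<Union>j\<in>{1..d}. embed ` S j) \<subseteq> lin.span ({0} \<union> var ` {1..n})"
        using linear lin.span_mono[of "var ` {1..n}" "{0} \<union> var ` {1..n}"] by blast
      show "embed f \<in> product_ideal (\<lambda>_. lin.span ({0} \<union> (\<Union>j\<in>A. embed ` S j))) A {0}"
        if A: "A \<subseteq> {1..d}" "A \<noteq> {}" for A
        using f[OF A] power_iff[OF A(1)]
        by (simp add: image_UN lin.span_insert_0)
    qed (auto simp: lin.span_zero)
    also have "product_ideal (\<lambda>j. embed ` S j) {1..d} {0} \<subseteq> product_ideal (\<lambda>j. embed ` S j) {1..d} {}"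
      by (intro product_ideal_least subspace_product_ideal) (auto intro: product_ideal_zero product_ideal_prod)
    finally show "f \<in> (\<Otimes>\<^bsub>ideals_set R\<^esub>j\<in>{1..d}. I j)"
      using f[of "{1..d}"] assms(3) power_iff[of "{1..d}"] unfolding prod_iff by auto
  qed
  moreover have "primaryideal (I_sum A [^]\<^bsub>ideals_set R\<^esub> card A) R"
    if "A \<noteq> {}" "A \<subseteq> {1..d}" for A
    unfolding I_sum[OF that(2)] R_def using S that fin[OF that(2)] by (intro primaryideal_Idl_power) blast+
  ultimately show ?thesis by blast
qed

end
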